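(* Let $M$ be an odd positive integer, let $N>M$ be an even integer, and let $n\ge 1$. The number of partitions of $n$ all of whose parts are either odd and different from $M$, or equal to $N$, is equal to the number of partitions $\lambda=(\lambda_1>\lambda_2>\cdots)$ of $n$ into distinct parts such that either (1) $\lambda$ has a single part, which is congruent to $0,1,\ldots,$ or $M-1$ modulo $N$; or (2) $\lambda$ has at least two parts, and $\lambda_1-\lambda_2-1$ is congruent to $0,1,\ldots,$ or $M-1$ modulo $N$. *)

theory Defs
  imports Main "HOL-Number_Theory.Cong"
begin

text \<open>
  A partition of \<open>n\<close> is represented by the list of its parts in weakly decreasing order, so that
  the part \<open>\<lambda>\<^sub>i\<close> is \<open>xs ! (i - 1)\<close>.
\<close>

definition partitions_of :: "nat \<Rightarrow> nat list set" where
  "partitions_of n = {xs. sorted_wrt (\<ge>) xs \<and> (\<forall>x\<in>set xs. 0 < x) \<and> sum_list xs = n}"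

definition distinct_partitions_of :: "nat \<Rightarrow> nat list set" where
  "distinct_partitions_of n = {xs \<in> partitions_of n. distinct xs}"

lemma distinct_partitions_of_alt:
  "distinct_partitions_of n =
     {xs. sorted_wrt (>) xs \<and> (\<forall>x\<in>set xs. 0 < x) \<and> sum_list xs = n}"
proof -
  have "sorted_wrt (>) xs \<longleftrightarrow> sorted_wrt (\<ge>) xs \<and> distinct xs" for xs :: "nat list"
    by (induction xs) (auto simp: order.order_iff_strict)
  then show ?thesis
    by (auto simp: distinct_partitions_of_def partitions_of_def)
qed

lemma finite_partitions_of: "finite (partitions_of n)"
proof (rule finite_subset)
  have "length xs \<le> sum_list xs" if "\<forall>x\<in>set xs. 0 < x" for xs :: "nat list"
    using that by (induction xs) auto
  then show "partitions_of n \<subseteq> {xs. set xs \<subseteq> {..n} \<and> length xs \<le> n}"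
    by (auto simp: partitions_of_def dest: member_le_sum_list)
  show "finite {xs. set xs \<subseteq> {..n} \<and> length xs \<le> n}"
    by (rule finite_lists_length_le) simp
qed

end

theory Submission
  imports Defs "HOL-Computational_Algebra.Formal_Power_Series"
begin

text \<open>
  Both sides are compared through their ordinary generating functions. Write \<open>O\<close> and \<open>D\<close> for the
  series of the partitions into odd parts and of the partitions into distinct parts. Both counts in
  question turn out to have the generating function \<open>(1 - X\<^sup>M) / (1 - X\<^sup>N)\<close> times \<open>O = D\<close>.

  For the partitions with restricted parts, one allowed part \<open>k\<close> contributes a factor
  \<open>1 / (1 - X\<^sup>k)\<close> (lemma \<open>ogf_partitions_insert\<close>). Passing from odd parts to the allowed parts removes
  the odd part \<open>M\<close> and adds the even part \<open>N\<close>.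

  For the partitions into distinct parts, call \<open>\<lambda>\<^sub>1 - \<lambda>\<^sub>2 - 1\<close> the gap of \<open>\<lambda>\<close>; under the convention
  \<open>\<lambda>\<^sub>2 = -1\<close> for a single part, the gap of a single part is that part itself, and the empty partition
  gets gap \<open>0\<close>. With these conventions, adding \<open>m\<close> to the largest part is a
  bijection from all partitions into distinct parts onto those whose gap is at least \<open>m\<close>
  (lemma \<open>bij_betw_grow\<close>). Taking \<open>m = M\<close>, the partitions of gap less than \<open>M\<close> have generating
  function \<open>(1 - X\<^sup>M) D\<close>. Taking \<open>m = N\<close>, which leaves the gap unchanged modulo \<open>N\<close>, they have
  generating function \<open>1 - X\<^sup>N\<close> times that of the partitions whose gap is congruent to one of
  \<open>0, \<dots>, M - 1\<close> modulo \<open>N\<close>.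

  What remains is Euler's theorem \<open>O = D\<close>, which is obtained from an identity between finite
  products (lemma \<open>euler_finite\<close>) by letting the bound on the parts grow.
\<close>

section \<open>Generating functions of graded families\<close>

definition ogf :: "(nat \<Rightarrow> 'a set) \<Rightarrow> int fps" where
  "ogf T = Abs_fps (\<lambda>n. int (card (T n)))"

lemma ogf_nth [simp]: "fps_nth (ogf T) n = int (card (T n))"
  by (simp add: ogf_def)

text \<open>
  The common pattern of all the recursions: each family splits into a part \<open>U\<close>, in which some
  feature is absent, and a part obtained from \<open>V\<close> by adding that feature at a cost of \<open>k\<close>.
\<close>

lemma ogf_split:
  fixes T U :: "nat \<Rightarrow> 'a set" and V :: "nat \<Rightarrow> 'b set"
  assumes fin: "\<And>n. finite (T n)"
    and sub: "\<And>n. U n \<subseteq> T n"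
    and low: "\<And>n. n < k \<Longrightarrow> T n \<subseteq> U n"
    and bij: "\<And>n. bij_betw f (V n) (T (n + k) - U (n + k))"
  shows "ogf T = ogf U + ogf V * fps_X ^ k"
proof (rule fps_ext)
  fix n
  show "fps_nth (ogf T) n = fps_nth (ogf U + ogf V * fps_X ^ k) n"
  proof (cases "n < k")
    case True
    then have "T n = U n" using low sub by blast
    then show ?thesis using True by (simp add: fps_X_power_mult_right_nth)
  next
    case False
    then have "card (V (n - k)) = card (T n - U n)"
      using bij_betw_same_card[OF bij[of "n - k"]] by simp
    moreover have "card (T n - U n) = card (T n) - card (U n)" "card (U n) \<le> card (T n)"
      using card_Diff_subset[OF finite_subset[OF sub fin] sub] card_mono[OF fin sub] by auto
    ultimately show ?thesis using False by (simp add: fps_X_power_mult_right_nth)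
  qed
qed

section \<open>Adding an allowed part\<close>

lemma rev_sort_eqI:
  fixes xs ys :: "nat list"
  assumes "mset xs = mset ys" and "sorted_wrt (\<ge>) ys"
  shows "rev (sort xs) = ys"
proof -
  have "sort xs = rev ys"
    using assms by (intro properties_for_sort) (simp_all add: sorted_wrt_rev)
  then show ?thesis by simp
qed

lemma sum_list_eq_if_mset_eq:
  fixes xs ys :: "nat list"
  shows "mset xs = mset ys \<Longrightarrow> sum_list xs = sum_list ys"
  by (metis sum_mset_sum_list)

lemma mset_Cons_remove1: "k \<in> set ys \<Longrightarrow> mset ys = mset (k # remove1 k ys)"
  by simp

lemma set_eq_insert_remove1: "k \<in> set ys \<Longrightarrow> set ys = insert k (set (remove1 k ys))"
  by (drule mset_Cons_remove1, drule mset_eq_setD) (simp only: list.set)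

text \<open>
  A weakly decreasing list is determined by its multiset of entries. Hence re-sorting after
  inserting or deleting one copy of \<open>k\<close> makes the two operations inverse to each other, for any
  property \<open>Pr\<close> that depends only on the multiset.
\<close>

lemma bij_betw_add_part:
  assumes k: "0 < k"
    and Pr: "\<And>xs ys. mset xs = mset ys \<Longrightarrow> Pr xs \<Longrightarrow> Pr ys"
  shows "bij_betw (\<lambda>xs. rev (sort (k # xs))) {xs \<in> partitions_of n. Pr xs}
           {ys \<in> partitions_of (n + k). k \<in> set ys \<and> Pr (remove1 k ys)}"
proof (rule bij_betw_byWitness[where f' = "\<lambda>ys. rev (sort (remove1 k ys))"], goal_cases)
  case 1
  have "rev (sort (remove1 k (rev (sort (k # xs))))) = xs" if "sorted_wrt (\<ge>) xs" for xs
    by (rule rev_sort_eqI) (use that in simp_all)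
  then show ?case by (auto simp: partitions_of_def simp del: sort_key_simps)
next
  case 2
  have "rev (sort (k # rev (sort (remove1 k ys)))) = ys" if "sorted_wrt (\<ge>) ys" "k \<in> set ys" for ys
    by (rule rev_sort_eqI) (use that in simp_all)
  then show ?case by (auto simp: partitions_of_def simp del: sort_key_simps)
next
  case 3
  have "rev (sort (k # xs)) \<in> {ys \<in> partitions_of (n + k). k \<in> set ys \<and> Pr (remove1 k ys)}"
    if xs: "xs \<in> partitions_of n" "Pr xs" for xs
  proof -
    let ?ys = "rev (sort (k # xs))"
    have ms: "mset ?ys = mset (k # xs)" by simp
    have "sum_list ?ys = sum_list (k # xs)" by (rule sum_list_eq_if_mset_eq[OF ms])
    moreover have "set ?ys = set (k # xs)" by (rule mset_eq_setD[OF ms])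
    moreover have "sorted_wrt (\<ge>) ?ys" by (subst sorted_wrt_rev) (rule sorted_sort)
    moreover have "Pr (remove1 k ?ys)"
      by (rule Pr[OF _ xs(2)]) (simp add: ms del: sort_key_simps)
    ultimately show ?thesis using xs k
      by (auto simp: partitions_of_def simp del: sort_key_simps)
  qed
  then show ?case by blast
next
  case 4
  have "rev (sort (remove1 k ys)) \<in> {xs \<in> partitions_of n. Pr xs}"
    if ys: "ys \<in> partitions_of (n + k)" "k \<in> set ys" "Pr (remove1 k ys)" for ys
  proof -
    let ?xs = "rev (sort (remove1 k ys))"
    have ms: "mset ?xs = mset (remove1 k ys)" by simp
    have "sum_list (k # remove1 k ys) = sum_list ys"
      by (rule sum_list_eq_if_mset_eq) (use ys(2) in simp)
    moreover have "sum_list ?xs = sum_list (remove1 k ys)" by (rule sum_list_eq_if_mset_eq[OF ms])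
    moreover have "set ?xs \<subseteq> set ys" using set_remove1_subset[of k ys] by simp
    moreover have "sorted_wrt (\<ge>) ?xs" by (subst sorted_wrt_rev) (rule sorted_sort)
    moreover have "Pr ?xs" by (rule Pr[OF ms[symmetric] ys(3)])
    ultimately show ?thesis using ys(1) by (auto simp: partitions_of_def)
  qed
  then show ?case by blast
qed

definition partitions_in :: "nat set \<Rightarrow> nat \<Rightarrow> nat list set" where
  "partitions_in S n = {xs \<in> partitions_of n. set xs \<subseteq> S}"

definition distinct_partitions_in :: "nat set \<Rightarrow> nat \<Rightarrow> nat list set" where
  "distinct_partitions_in S n = {xs \<in> distinct_partitions_of n. set xs \<subseteq> S}"

lemma finite_distinct_partitions_of: "finite (distinct_partitions_of n)"
  using finite_partitions_of by (simp add: distinct_partitions_of_def)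

lemma part_le: "xs \<in> partitions_of n \<Longrightarrow> x \<in> set xs \<Longrightarrow> 0 < x \<and> x \<le> n"
  by (auto simp: partitions_of_def member_le_sum_list)

text \<open>
  Removing one copy of \<open>k\<close> from a partition that contains it leaves a partition in which \<open>k\<close> may
  still occur, so the family itself reappears on the right of the recursion. For distinct parts,
  \<open>k\<close> is gone after the removal, which turns the factor \<open>1 / (1 - X\<^sup>k)\<close> into \<open>1 + X\<^sup>k\<close>.
\<close>

lemma ogf_partitions_insert:
  assumes "0 < k" and "k \<notin> S"
  shows "ogf (partitions_in (insert k S)) * (1 - fps_X ^ k) = ogf (partitions_in S)"
proof -
  have "ogf (partitions_in (insert k S)) =
          ogf (partitions_in S) + ogf (partitions_in (insert k S)) * fps_X ^ k"
  proof (rule ogf_split)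
    show "finite (partitions_in (insert k S) n)" for n
      using finite_partitions_of by (simp add: partitions_in_def)
    show "partitions_in S n \<subseteq> partitions_in (insert k S) n" for n
      by (auto simp: partitions_in_def)
    show "partitions_in (insert k S) n \<subseteq> partitions_in S n" if "n < k" for n
      using that by (fastforce simp: partitions_in_def dest: part_le)
    show "bij_betw (\<lambda>xs. rev (sort (k # xs))) (partitions_in (insert k S) n)
            (partitions_in (insert k S) (n + k) - partitions_in S (n + k))" for n
    proof -
      have "set ys \<subseteq> insert k S \<longleftrightarrow> set (remove1 k ys) \<subseteq> insert k S" if "k \<in> set ys" for ys
        using set_eq_insert_remove1[OF that] by blast
      then have "partitions_in (insert k S) (n + k) - partitions_in S (n + k) =
          {ys \<in> partitions_of (n + k). k \<in> set ys \<and> set (remove1 k ys) \<subseteq> insert k S}"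
        using assms(2) by (auto simp: partitions_in_def)
      moreover have "bij_betw (\<lambda>xs. rev (sort (k # xs))) (partitions_in (insert k S) n)
          {ys \<in> partitions_of (n + k). k \<in> set ys \<and> set (remove1 k ys) \<subseteq> insert k S}"
        unfolding partitions_in_def
        by (rule bij_betw_add_part) (use assms(1) in \<open>auto dest: mset_eq_setD\<close>)
      ultimately show ?thesis by simp
    qed
  qed
  then show ?thesis by (simp add: algebra_simps)
qed

lemma ogf_distinct_partitions_insert:
  assumes "0 < k" and "k \<notin> S"
  shows "ogf (distinct_partitions_in (insert k S)) = ogf (distinct_partitions_in S) * (1 + fps_X ^ k)"
proof -
  have "ogf (distinct_partitions_in (insert k S)) =
          ogf (distinct_partitions_in S) + ogf (distinct_partitions_in S) * fps_X ^ k"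
  proof (rule ogf_split)
    show "finite (distinct_partitions_in (insert k S) n)" for n
      using finite_distinct_partitions_of by (simp add: distinct_partitions_in_def)
    show "distinct_partitions_in S n \<subseteq> distinct_partitions_in (insert k S) n" for n
      by (auto simp: distinct_partitions_in_def)
    show "distinct_partitions_in (insert k S) n \<subseteq> distinct_partitions_in S n" if "n < k" for n
      using that by (fastforce simp: distinct_partitions_in_def distinct_partitions_of_def dest: part_le)
    show "bij_betw (\<lambda>xs. rev (sort (k # xs))) (distinct_partitions_in S n)
            (distinct_partitions_in (insert k S) (n + k) - distinct_partitions_in S (n + k))" for n
    proof -
      have "distinct ys \<and> set ys \<subseteq> insert k S \<longleftrightarrow>
              distinct (remove1 k ys) \<and> set (remove1 k ys) \<subseteq> S" if "k \<in> set ys" for ys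
      proof -
        have "distinct ys \<longleftrightarrow> k \<notin> set (remove1 k ys) \<and> distinct (remove1 k ys)"
          using mset_eq_imp_distinct_iff[OF mset_Cons_remove1[OF that]]
          by (simp only: distinct.simps)
        then show ?thesis using assms(2) set_eq_insert_remove1[OF that] by blast
      qed
      then have "distinct_partitions_in (insert k S) (n + k) - distinct_partitions_in S (n + k) =
          {ys \<in> partitions_of (n + k). k \<in> set ys \<and>
             distinct (remove1 k ys) \<and> set (remove1 k ys) \<subseteq> S}"
        using assms(2) by (auto simp: distinct_partitions_in_def distinct_partitions_of_def)
      moreover have "bij_betw (\<lambda>xs. rev (sort (k # xs)))
          {xs \<in> partitions_of n. distinct xs \<and> set xs \<subseteq> S}
          {ys \<in> partitions_of (n + k). k \<in> set ys \<and>
             distinct (remove1 k ys) \<and> set (remove1 k ys) \<subseteq> S}"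
        by (rule bij_betw_add_part)
          (use assms(1) in \<open>auto dest: mset_eq_setD mset_eq_imp_distinct_iff\<close>)
      moreover have "distinct_partitions_in S n =
          {xs \<in> partitions_of n. distinct xs \<and> set xs \<subseteq> S}"
        by (auto simp: distinct_partitions_in_def distinct_partitions_of_def)
      ultimately show ?thesis by simp
    qed
  qed
  then show ?thesis by (simp add: algebra_simps)
qed

section \<open>Euler's theorem on odd and distinct parts\<close>

lemma one_minus_fps_X_power_neq_0:
  assumes "0 < k"
  shows "1 - fps_X ^ k \<noteq> (0 :: int fps)"
proof
  assume "1 - fps_X ^ k = (0 :: int fps)"
  then have "fps_nth (1 - fps_X ^ k :: int fps) 0 = 0" by simp
  then show False using assms by (simp add: fps_X_power_iff)
qed

text \<open>
  Induction on \<open>K\<close>: after multiplication by \<open>1 - X\<^bsup>K + 1\<^esup>\<close>, the new factor \<open>1 + X\<^bsup>K + 1\<^esup>\<close> on the left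
  becomes \<open>1 - X\<^bsup>2 K + 2\<^esup>\<close>, which enters the product on the right, while the factor \<open>1 - X\<^bsup>2 K + 1\<^esup>\<close>
  there pays for the new odd part \<open>2 K + 1\<close>.
\<close>

lemma euler_finite:
  "ogf (distinct_partitions_in {1..K}) =
     ogf (partitions_in {i. odd i \<and> i < 2 * K}) * (\<Prod>i\<in>{K + 1..2 * K}. 1 - fps_X ^ i)"
proof (induction K)
  case 0
  show ?case
    by (rule fps_ext)
      (auto simp: distinct_partitions_in_def partitions_in_def distinct_partitions_of_def
        intro!: arg_cong[where f = card])
next
  case (Suc K)
  let ?Q = "\<lambda>K. ogf (distinct_partitions_in {1..K})"
  let ?P = "\<lambda>K. ogf (partitions_in {i. odd i \<and> i < 2 * K})"
  let ?R = "\<lambda>K. \<Prod>i\<in>{K + 1..2 * K}. 1 - fps_X ^ i :: int fps"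
  let ?e = "\<lambda>k. 1 - fps_X ^ k :: int fps"
  have "{i. odd i \<and> i < 2 * Suc K} = insert (2 * K + 1) {i. odd i \<and> i < 2 * K}"
    by (auto simp: less_Suc_eq)
  then have P: "?P K = ?P (Suc K) * ?e (2 * K + 1)"
    using ogf_partitions_insert[of "2 * K + 1" "{i. odd i \<and> i < 2 * K}"] by simp
  have "{1..Suc K} = insert (K + 1) {1..K}" by auto
  then have Q: "?Q (Suc K) = ?Q K * (1 + fps_X ^ (K + 1))"
    using ogf_distinct_partitions_insert[of "K + 1" "{1..K}"] by simp
  have "{K + 1..2 * Suc K} = insert (K + 1) {Suc K + 1..2 * Suc K}" by auto
  then have "(\<Prod>i\<in>{K + 1..2 * Suc K}. ?e i) = ?e (K + 1) * ?R (Suc K)" by simp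
  moreover have "{K + 1..2 * Suc K} = insert (2 * K + 2) (insert (2 * K + 1) {K + 1..2 * K})" by auto
  then have "(\<Prod>i\<in>{K + 1..2 * Suc K}. ?e i) = ?e (2 * K + 2) * (?e (2 * K + 1) * ?R K)" by simp
  ultimately have R: "?R (Suc K) * ?e (K + 1) = ?R K * ?e (2 * K + 1) * ?e (2 * K + 2)"
    by (simp only: mult_ac)
  have e: "(1 + fps_X ^ (K + 1)) * ?e (K + 1) = ?e (2 * K + 2)"
    by (simp add: algebra_simps flip: power_add mult_2)
  have "?Q (Suc K) * ?e (K + 1) = ?Q K * ((1 + fps_X ^ (K + 1)) * ?e (K + 1))"
    by (simp only: Q mult.assoc)
  also have "\<dots> = ?P (Suc K) * (?R K * ?e (2 * K + 1) * ?e (2 * K + 2))"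
    unfolding e Suc.IH P by (simp only: mult_ac)
  also have "\<dots> = ?P (Suc K) * (?R (Suc K) * ?e (K + 1))"
    by (simp only: R)
  also have "\<dots> = ?P (Suc K) * ?R (Suc K) * ?e (K + 1)"
    by (simp only: mult.assoc)
  finally show ?case
    using one_minus_fps_X_power_neq_0[of "K + 1"] by simp
qed

lemma fps_nth_mult_prod_one_minus_X_power:
  fixes F :: "int fps"
  assumes "finite I" and "\<And>i. i \<in> I \<Longrightarrow> n < i"
  shows "fps_nth (F * (\<Prod>i\<in>I. 1 - fps_X ^ i)) n = fps_nth F n"
  using assms
proof (induction I arbitrary: F rule: finite_induct)
  case (insert i I)
  have "fps_nth (F * (\<Prod>j\<in>insert i I. 1 - fps_X ^ j)) n =
        fps_nth ((F * (1 - fps_X ^ i)) * (\<Prod>j\<in>I. 1 - fps_X ^ j)) n"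
    using insert.hyps by (simp add: mult.assoc)
  also have "\<dots> = fps_nth (F * (1 - fps_X ^ i)) n"
    using insert.prems by (intro insert.IH) auto
  also have "\<dots> = fps_nth F n"
    using insert.prems[of i] by (simp add: right_diff_distrib fps_X_power_mult_right_nth)
  finally show ?case .
qed simp

text \<open>
  Parts larger than \<open>n\<close> do not occur in partitions of \<open>n\<close>, so the coefficients of index \<open>n\<close> can be
  read off from the finite identity for \<open>K = n\<close>, in which the product on the right is
  \<open>1 + O(X\<^bsup>n + 1\<^esup>)\<close>.
\<close>

theorem euler_odd_distinct: "ogf (partitions_in {i. odd i}) = ogf distinct_partitions_of"
proof (rule fps_ext)
  fix n
  have "distinct_partitions_of n = distinct_partitions_in {1..n} n"
    by (fastforce simp: distinct_partitions_in_def distinct_partitions_of_def dest: part_le)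
  moreover have "partitions_in {i. odd i} n = partitions_in {i. odd i \<and> i < 2 * n} n"
    by (fastforce simp: partitions_in_def dest: part_le)
  moreover have "fps_nth (ogf (distinct_partitions_in {1..n})) n =
      fps_nth (ogf (partitions_in {i. odd i \<and> i < 2 * n})) n"
    unfolding euler_finite by (rule fps_nth_mult_prod_one_minus_X_power) auto
  ultimately show "fps_nth (ogf (partitions_in {i. odd i})) n = fps_nth (ogf distinct_partitions_of) n"
    by simp
qed

section \<open>The gap below the largest part\<close>

text \<open>
  The values on the empty list and on singletons are those which make \<open>grow\<close> below raise the gap
  by exactly \<open>m\<close>, also when it turns the empty partition into the single part \<open>m\<close>.
\<close>

fun gap :: "nat list \<Rightarrow> nat" where
  "gap [] = 0"
| "gap [x] = x"
| "gap (x # y # xs) = x - y - 1"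

fun grow :: "nat \<Rightarrow> nat list \<Rightarrow> nat list" where
  "grow m [] = [m]"
| "grow m (x # xs) = (x + m) # xs"

text \<open>
  The inverse subtracts \<open>m\<close> from the largest part and drops the result if it is \<open>0\<close>. A gap of at
  least \<open>m\<close> means that afterwards the largest part still exceeds the second one.
\<close>

lemma bij_betw_grow:
  assumes m: "0 < m"
  shows "bij_betw (grow m) {xs \<in> distinct_partitions_of n. Pr (gap xs)}
           {ys \<in> distinct_partitions_of (n + m). m \<le> gap ys \<and> Pr (gap ys - m)}"
proof (rule bij_betw_byWitness
    [where f' = "\<lambda>ys. if ys = [m] then [] else (hd ys - m) # tl ys"], goal_cases)
  case 1
  have "(if grow m xs = [m] then [] else (hd (grow m xs) - m) # tl (grow m xs)) = xs"
    if "xs \<in> distinct_partitions_of n" for xs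
    using that by (cases xs) (auto simp: distinct_partitions_of_alt)
  then show ?case by blast
next
  case 2
  have "grow m (if ys = [m] then [] else (hd ys - m) # tl ys) = ys" if "m \<le> gap ys" for ys
    using that m by (cases ys rule: gap.cases) auto
  then show ?case by blast
next
  case 3
  have "grow m xs \<in> distinct_partitions_of (n + m) \<and> gap (grow m xs) = gap xs + m"
    if "xs \<in> distinct_partitions_of n" for xs
    using that m by (cases xs rule: gap.cases) (auto simp: distinct_partitions_of_alt)
  then show ?case by auto
next
  case 4
  have "(if ys = [m] then [] else (hd ys - m) # tl ys) \<in> distinct_partitions_of n \<and>
        gap (if ys = [m] then [] else (hd ys - m) # tl ys) = gap ys - m"
    if "ys \<in> distinct_partitions_of (n + m)" "m \<le> gap ys" for ys
    using that m by (cases ys rule: gap.cases) (auto simp: distinct_partitions_of_alt)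
  then show ?case
    by (intro image_subsetI) (simp only: mem_Collect_eq)
qed

lemma gap_le: "xs \<in> distinct_partitions_of n \<Longrightarrow> gap xs \<le> n"
  by (cases xs rule: gap.cases) (auto simp: distinct_partitions_of_alt)

text \<open>
  Both families, with the gap unrestricted and with the gap restricted modulo \<open>N\<close>, contain the
  partitions of gap less than \<open>M\<close>; the rest is obtained by growing the same family by \<open>M\<close> and by
  \<open>N\<close>, respectively. Eliminating the common part gives the identity.
\<close>

lemma ogf_gap_mod:
  assumes "0 < M" and "M < N"
  shows "ogf (\<lambda>n. {xs \<in> distinct_partitions_of n. gap xs mod N < M}) * (1 - fps_X ^ N) =
         ogf distinct_partitions_of * (1 - fps_X ^ M)"
proof -
  let ?D = distinct_partitions_of
  let ?U = "\<lambda>n. {xs \<in> ?D n. gap xs < M}"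
  let ?G = "\<lambda>n. {xs \<in> ?D n. gap xs mod N < M}"
  have "ogf ?D = ogf ?U + ogf ?D * fps_X ^ M"
  proof (rule ogf_split)
    show "bij_betw (grow M) (?D n) (?D (n + M) - ?U (n + M))" for n
    proof -
      have "?D (n + M) - ?U (n + M) = {ys \<in> ?D (n + M). M \<le> gap ys}" by auto
      then show ?thesis using bij_betw_grow[OF assms(1), of n "\<lambda>_. True"] by simp
    qed
  qed (use finite_distinct_partitions_of in \<open>auto dest: gap_le\<close>)
  moreover have "ogf ?G = ogf ?U + ogf ?G * fps_X ^ N"
  proof (rule ogf_split)
    show "?G n \<subseteq> ?U n" if "n < N" for n
    proof -
      have "gap xs mod N = gap xs" if "xs \<in> ?D n" for xs
        using gap_le[OF that] \<open>n < N\<close> by simp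
      then show ?thesis by auto
    qed
    show "bij_betw (grow N) (?G n) (?G (n + N) - ?U (n + N))" for n
    proof -
      have "g mod N < M \<and> \<not> g < M \<longleftrightarrow> N \<le> g \<and> (g - N) mod N < M" for g
        using assms by (cases "g < N") (auto simp: le_mod_geq not_less)
      then have "?G (n + N) - ?U (n + N) =
          {ys \<in> ?D (n + N). N \<le> gap ys \<and> (gap ys - N) mod N < M}"
        by blast
      then show ?thesis using bij_betw_grow[of N n "\<lambda>g. g mod N < M"] assms by simp
    qed
  qed (use assms finite_distinct_partitions_of in auto)
  moreover have "a * (1 - x) = u" if "a = u + a * x" for a u x :: "int fps"
    using that by (simp add: algebra_simps)
  ultimately have "ogf ?D * (1 - fps_X ^ M) = ogf ?U" "ogf ?G * (1 - fps_X ^ N) = ogf ?U"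
    by blast+
  then show ?thesis by (simp only:)
qed

section \<open>Comparison of the two counts\<close>

theorem corollary5p5:
  fixes M N n :: nat
  assumes "odd M" and "0 < M" and "even N" and "M < N" and "1 \<le> n"
  shows "card {xs \<in> partitions_of n. \<forall>x\<in>set xs. (odd x \<and> x \<noteq> M) \<or> x = N} =
         card {xs \<in> distinct_partitions_of n.
                 (length xs = 1 \<and> (\<exists>r<M. [xs ! 0 = r] (mod N))) \<or>
                 (2 \<le> length xs \<and> (\<exists>r<M. [xs ! 0 - xs ! 1 - 1 = r] (mod N)))}"
proof -
  let ?S = "{i. odd i \<and> i \<noteq> M}"
  let ?A = "ogf (partitions_in (insert N ?S))"
  let ?B = "ogf (\<lambda>n. {xs \<in> distinct_partitions_of n. gap xs mod N < M})"
  have "?A * (1 - fps_X ^ N) = ogf (partitions_in ?S)"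
    using assms by (intro ogf_partitions_insert) auto
  also have "\<dots> = ogf (partitions_in (insert M ?S)) * (1 - fps_X ^ M)"
    using assms by (intro ogf_partitions_insert[symmetric]) auto
  also have "insert M ?S = {i. odd i}"
    using assms by auto
  also have "ogf (partitions_in {i. odd i}) * (1 - fps_X ^ M) = ?B * (1 - fps_X ^ N)"
    using assms by (simp add: euler_odd_distinct ogf_gap_mod)
  finally have "?A = ?B"
    using one_minus_fps_X_power_neq_0[of N] assms by simp
  then have "fps_nth ?A n = fps_nth ?B n" by simp
  moreover have "partitions_in (insert N ?S) n =
      {xs \<in> partitions_of n. \<forall>x\<in>set xs. (odd x \<and> x \<noteq> M) \<or> x = N}"
    by (auto simp: partitions_in_def)
  moreover have "{xs \<in> distinct_partitions_of n. gap xs mod N < M} =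
      {xs \<in> distinct_partitions_of n.
         (length xs = 1 \<and> (\<exists>r<M. [xs ! 0 = r] (mod N))) \<or>
         (2 \<le> length xs \<and> (\<exists>r<M. [xs ! 0 - xs ! 1 - 1 = r] (mod N)))}"
  proof (rule Collect_cong, rule conj_cong[OF refl])
    fix xs assume xs: "xs \<in> distinct_partitions_of n"
    have cong: "(\<exists>r<M. [g = r] (mod N)) \<longleftrightarrow> g mod N < M" for g
      using assms(4) by (auto simp: cong_def)
    show "gap xs mod N < M \<longleftrightarrow>
      (length xs = 1 \<and> (\<exists>r<M. [xs ! 0 = r] (mod N))) \<or>
      (2 \<le> length xs \<and> (\<exists>r<M. [xs ! 0 - xs ! 1 - 1 = r] (mod N)))"
      unfolding cong
      \<comment> \<open>Since \<open>n\<close> is positive, the empty partition does not occur here.\<close>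
      using xs assms(5) by (cases xs rule: gap.cases) (auto simp: distinct_partitions_of_alt)
  qed
  ultimately show ?thesis by simp
qed

end
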